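(* Let $m,\ell\geq 1$ be integers. Each of the following symmetric matrices with zero diagonal and entries in $\{0,\pm1\}$ is the adjacency matrix of a signed graph having all but at most two eigenvalues equal to $\pm1$; more precisely they have the stated spectra (multiplicities as exponents): \begin{enumerate} \item $A_1=\begin{bmatrix} J-I_m & J\\ J & -R_{2\ell}\end{bmatrix}$ (block sizes $m,2\ell$), with spectrum $\{-1^{\ell+m-2},1^{\ell},\tfrac12(m-2\pm\sqrt{m(m+8\ell)})\}$; \item $A_2=\begin{bmatrix} R_{2m} & J\\ J & -R_{2\ell}\end{bmatrix}$ (block sizes $2m,2\ell$), with spectrum $\{-1^{m+\ell-1},1^{m+\ell-1},\pm\sqrt{1+4m\ell}\}$; \item $A_3=\begin{bmatrix} J-I_m & \mathbf{1} & \mathbf{1} & O\\ \mathbf{1}^\top & 0 & 1 & -\mathbf{1}^\top\\ \mathbf{1}^\top & 1 & 0 & \mathbf{1}^\top\\ O & -\mathbf{1} & \mathbf{1} & I_\ell-J\end{bmatrix}$ (block sizes $m,1,1,\ell$), with spectrum $\{-1^{m},1^{\ell},-\ell-1,m+1\}$; \item $A_4=\begin{bmatrix} J-I_m & J & O & J\\ J & R_2 & O & O\\ O & O & -R_2 & -J\\ J & O & -J & I_\ell-J\end{bmatrix}$ (block sizes $m,2,2,\ell$), with spectrum $\{-1^{m+1},1^{\ell+1},\tfrac12(m-\ell\pm\sqrt{m^2+\ell^2+6m\ell+4m+4\ell+4})\}$. \end{enumerate}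
   Context: $J$ denotes an all-ones matrix, $O$ an all-zeros matrix, $\mathbf{1}$ an all-ones column vector, of sizes determined by the block structure; $I_k$ is the $k\times k$ identity. $R_k$ is the $k\times k$ reverse identity matrix: $R_k(i,j)=1$ if $i+j=k+1$ and $0$ otherwise. A signed graph is a finite simple graph with a signature $\sigma:E\to\{-1,+1\}$; its adjacency matrix has entry $\sigma(\{u,v\})$ for edges and $0$ otherwise. *)

theory Defs
  imports Complex_Main "HOL-Library.Multiset" "Jordan_Normal_Form.Char_Poly"
begin

definition ones_mat :: "nat \<Rightarrow> nat \<Rightarrow> real mat" where
  "ones_mat nr nc = mat nr nc (\<lambda>_. 1)"

text \<open>Matrix indices start at 0, so the condition \<open>i + j = k + 1\<close> on 1-based indices
  becomes \<open>i + j + 1 = k\<close>.\<close>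

definition rev_id_mat :: "nat \<Rightarrow> real mat" where
  "rev_id_mat k = mat k k (\<lambda>(i, j). if i + j + 1 = k then 1 else 0)"

text \<open>The 16 blocks are given row by row. The block sizes are determined by the diagonal
  blocks of the nested \<open>2 \<times> 2\<close> block matrices.\<close>

definition block4_mat ::
  "'a mat \<Rightarrow> 'a mat \<Rightarrow> 'a mat \<Rightarrow> 'a mat \<Rightarrow>
   'a mat \<Rightarrow> 'a mat \<Rightarrow> 'a mat \<Rightarrow> 'a mat \<Rightarrow>
   'a mat \<Rightarrow> 'a mat \<Rightarrow> 'a mat \<Rightarrow> 'a mat \<Rightarrow>
   'a mat \<Rightarrow> 'a mat \<Rightarrow> 'a mat \<Rightarrow> 'a mat \<Rightarrow> 'a mat" where
  "block4_mat
     B11 B12 B13 B14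
     B21 B22 B23 B24
     B31 B32 B33 B34
     B41 B42 B43 B44 =
   four_block_mat
     (four_block_mat B11 B12 B21 B22) (four_block_mat B13 B14 B23 B24)
     (four_block_mat B31 B32 B41 B42) (four_block_mat B33 B34 B43 B44)"

definition A1 :: "nat \<Rightarrow> nat \<Rightarrow> real mat" where
  "A1 m l = four_block_mat
     (ones_mat m m - 1\<^sub>m m)  (ones_mat m (2 * l))
     (ones_mat (2 * l) m)    (- rev_id_mat (2 * l))"

definition A2 :: "nat \<Rightarrow> nat \<Rightarrow> real mat" where
  "A2 m l = four_block_mat
     (rev_id_mat (2 * m))        (ones_mat (2 * m) (2 * l))
     (ones_mat (2 * l) (2 * m))  (- rev_id_mat (2 * l))"

definition A3 :: "nat \<Rightarrow> nat \<Rightarrow> real mat" where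
  "A3 m l = block4_mat
     (ones_mat m m - 1\<^sub>m m)  (ones_mat m 1)    (ones_mat m 1)  (0\<^sub>m m l)
     (ones_mat 1 m)          (0\<^sub>m 1 1)          (ones_mat 1 1)  (- ones_mat 1 l)
     (ones_mat 1 m)          (ones_mat 1 1)    (0\<^sub>m 1 1)        (ones_mat 1 l)
     (0\<^sub>m l m)                (- ones_mat l 1)  (ones_mat l 1)  (1\<^sub>m l - ones_mat l l)"

definition A4 :: "nat \<Rightarrow> nat \<Rightarrow> real mat" where
  "A4 m l = block4_mat
     (ones_mat m m - 1\<^sub>m m)  (ones_mat m 2)  (0\<^sub>m m 2)          (ones_mat m l)
     (ones_mat 2 m)          (rev_id_mat 2)  (0\<^sub>m 2 2)          (0\<^sub>m 2 l)
     (0\<^sub>m 2 m)                (0\<^sub>m 2 2)        (- rev_id_mat 2)  (- ones_mat 2 l)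
     (ones_mat l m)          (0\<^sub>m l 2)        (- ones_mat l 2)  (1\<^sub>m l - ones_mat l l)"

definition signed_graph :: "'v set \<Rightarrow> 'v set set \<Rightarrow> ('v set \<Rightarrow> int) \<Rightarrow> bool" where
  "signed_graph V E \<sigma> \<longleftrightarrow>
     finite V \<and> E \<subseteq> {e. e \<subseteq> V \<and> card e = 2} \<and> (\<forall>e\<in>E. \<sigma> e \<in> {-1, 1})"

text \<open>The list \<open>vs\<close> enumerates the vertices and fixes the order of the rows and columns.\<close>

definition signed_adjacency_mat :: "'v list \<Rightarrow> 'v set set \<Rightarrow> ('v set \<Rightarrow> int) \<Rightarrow> real mat" where
  "signed_adjacency_mat vs E \<sigma> = mat (length vs) (length vs)
     (\<lambda>(i, j). if {vs ! i, vs ! j} \<in> E then of_int (\<sigma> {vs ! i, vs ! j}) else 0)"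

definition is_signed_graph_adjacency_mat :: "real mat \<Rightarrow> bool" where
  "is_signed_graph_adjacency_mat A \<longleftrightarrow>
     (\<exists>(vs :: nat list) E \<sigma>. distinct vs \<and> signed_graph (set vs) E \<sigma> \<and>
        A = signed_adjacency_mat vs E \<sigma>)"

text \<open>Eigenvalues with algebraic multiplicity, which for a real symmetric matrix are all real
  and have the same geometric multiplicity.\<close>

definition eigenvalues_mset :: "real mat \<Rightarrow> real multiset" where
  "eigenvalues_mset A = proots (char_poly A)"

end

theory Submission
  imports Defs
begin

text \<open>Each matrix is \<open>A = D + U W\<close>, where \<open>D\<close> is a block diagonal matrix with blocks \<open>\<plusminus>I\<close> and
  \<open>\<plusminus>R\<close>, the columns of \<open>U\<close> are the indicator vectors of the blocks, and \<open>D U = U S\<close> with \<open>S\<close>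
  diagonal. Conjugating the block matrix with rows \<open>(A, 0)\<close>, \<open>(W, S)\<close> by the unipotent matrix
  with rows \<open>(I, U)\<close>, \<open>(0, I)\<close> gives the one with rows \<open>(D, 0)\<close>, \<open>(W, S + W U)\<close>. Hence
  \<open>\<chi>\<^sub>A \<chi>\<^sub>S = \<chi>\<^sub>D \<chi>\<^sub>Q\<close> with the quotient matrix \<open>Q = S + W U\<close> of size 2 or 4, and
  both \<open>\<chi>\<^sub>S\<close> and \<open>\<chi>\<^sub>D\<close> are products of powers of \<open>x - 1\<close> and \<open>x + 1\<close>.\<close>

section \<open>Block triangular matrices and intertwining\<close>

text \<open>Subtracting from \<open>x I\<close> keeps the corner zero, so the determinant over the
  polynomial ring factors along the diagonal blocks.\<close>

lemma char_poly_four_block_upper_right_zero: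
  fixes A :: "'a :: idom mat"
  assumes A: "A \<in> carrier_mat n n" and C: "C \<in> carrier_mat k n" and D: "D \<in> carrier_mat k k"
  shows "char_poly (four_block_mat A (0\<^sub>m n k) C D) = char_poly A * char_poly D"
proof -
  have "char_poly_matrix (four_block_mat A (0\<^sub>m n k) C D) =
    four_block_mat (char_poly_matrix A) (0\<^sub>m n k) (map_mat (\<lambda>a. [:- a:]) C) (char_poly_matrix D)"
    using assms by (intro eq_matI) (auto simp: char_poly_matrix_def)
  then show ?thesis
    unfolding char_poly_def
    using det_four_block_mat_upper_right_zero
      [of "char_poly_matrix A" n _ k "map_mat (\<lambda>a. [:- a:]) C" "char_poly_matrix D"] assms
    by auto
qed

text \<open>Kept as an equation of products; the factor \<open>char_poly S\<close> is cancelled only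
  once it is known explicitly.\<close>

lemma char_poly_mult_char_poly_intertwined:
  fixes A :: "'a :: idom mat"
  assumes D: "D \<in> carrier_mat n n" and U: "U \<in> carrier_mat n k" and W: "W \<in> carrier_mat k n"
    and S: "S \<in> carrier_mat k k" and A: "A = D + U * W" and DU: "D * U = U * S"
  shows "char_poly A * char_poly S = char_poly D * char_poly (S + W * U)"
proof -
  let ?P = "four_block_mat (1\<^sub>m n) U (0\<^sub>m k n) (1\<^sub>m k)"
  let ?P' = "four_block_mat (1\<^sub>m n) (- U) (0\<^sub>m k n) (1\<^sub>m k)"
  let ?X = "four_block_mat A (0\<^sub>m n k) W S"
  let ?Y = "four_block_mat D (0\<^sub>m n k) W (S + W * U)"
  have A': "A \<in> carrier_mat n n" using A D U W by auto
  have Um: "- U \<in> carrier_mat n k" using U by auto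
  have SWU: "S + W * U \<in> carrier_mat k k" using S W U by auto
  have UU: "U + - U = 0\<^sub>m n k" "- U + U = 0\<^sub>m n k" using U by auto
  have zero: "- 0\<^sub>m k k = (0\<^sub>m k k :: 'a mat)" by auto
  have PP': "?P * ?P' = 1\<^sub>m (n + k)"
    using U Um UU zero by (subst mult_four_block_mat[where ?nr1.0=n and ?n1.0=n and ?n2.0=k
        and ?nr2.0=k and ?nc1.0=n and ?nc2.0=k]) simp_all
  have P'P: "?P' * ?P = 1\<^sub>m (n + k)"
    using U Um UU zero by (subst mult_four_block_mat[where ?nr1.0=n and ?n1.0=n and ?n2.0=k
        and ?nr2.0=k and ?nc1.0=n and ?nc2.0=k]) simp_all
  have XP: "?X * ?P = four_block_mat A (A * U) W (W * U + S)"
    using A' U W S by (subst mult_four_block_mat[where ?nr1.0=n and ?n1.0=n and ?n2.0=k and ?nr2.0=k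
        and ?nc1.0=n and ?nc2.0=k]) auto
  \<comment> \<open>\<open>A U = D U + U W U\<close>, and \<open>D U = U S\<close> lets
    \<open>U\<close> be pulled out on the left.\<close>
  have AU: "A * U = U * (S + W * U)"
    unfolding A using D U W S
    by (simp add: add_mult_distrib_mat[of _ n n] mult_add_distrib_mat[of _ n k] DU)
  have PY: "?P * ?Y = four_block_mat (D + U * W) (U * (S + W * U)) W (S + W * U)"
    using D U W S SWU by (subst mult_four_block_mat[where ?nr1.0=n and ?n1.0=n and ?n2.0=k and ?nr2.0=k
        and ?nc1.0=n and ?nc2.0=k]) auto
  have comm: "?X * ?P = ?P * ?Y"
    unfolding XP PY AU using comm_add_mat[OF S, of "W * U"] W U A by simp
  have car: "?X \<in> carrier_mat (n + k) (n + k)" "?Y \<in> carrier_mat (n + k) (n + k)"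
    "?P \<in> carrier_mat (n + k) (n + k)" "?P' \<in> carrier_mat (n + k) (n + k)"
    using A' S SWU D by auto
  \<comment> \<open>Since \<open>?P'\<close> inverts \<open>?P\<close>, the relation
    \<open>X P = P Y\<close> becomes \<open>X = P Y P'\<close>, the form required for
    similarity.\<close>
  have "?X = ?X * (?P * ?P')" using right_mult_one_mat[OF car(1)] PP' by simp
  also have "\<dots> = ?X * ?P * ?P'" by (rule assoc_mult_mat[OF car(1,3,4), symmetric])
  also have "\<dots> = ?P * ?Y * ?P'" by (simp only: comm)
  finally have "similar_mat ?X ?Y"
    unfolding similar_mat_def using similar_mat_witI[OF PP' P'P _ car] by blast
  from char_poly_similar[OF this] show ?thesis
    using char_poly_four_block_upper_right_zero[OF A' W S]
      char_poly_four_block_upper_right_zero[OF D W SWU] by simp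
qed

lemma char_poly_diag:
  fixes d :: "nat \<Rightarrow> 'a :: comm_ring_1"
  shows "char_poly (mat k k (\<lambda>(p, q). if p = q then d p else 0)) = (\<Prod>p<k. [:- d p, 1:])"
proof -
  let ?S = "mat k k (\<lambda>(p, q). if p = q then d p else 0)"
  have "char_poly ?S = (\<Prod>a\<leftarrow>diag_mat ?S. [:- a, 1:])"
    by (rule char_poly_upper_triangular[of _ k]) auto
  also have "diag_mat ?S = map d [0..<k]" by (auto simp: diag_mat_def)
  finally show ?thesis
    by (simp add: prod.list_conv_set_nth atLeast0LessThan)
qed

text \<open>\<open>c i\<close> is the cell of the index \<open>i\<close>, and \<open>N q\<close> the size of the cell \<open>q\<close>: away from the
  monomial matrix \<open>D\<close>, the entries of \<open>A\<close> depend only on the cells.\<close>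

lemma char_poly_equitable_partition:
  fixes A D :: "'a :: idom mat" and C :: "nat \<Rightarrow> nat \<Rightarrow> 'a"
  assumes A: "A \<in> carrier_mat n n" and D: "D \<in> carrier_mat n n"
    and c: "\<And>i. i < n \<Longrightarrow> c i < k"
    and \<pi>: "\<And>i. i < n \<Longrightarrow> \<pi> i < n \<and> c (\<pi> i) = c i"
    and D_entry: "\<And>i j. i < n \<Longrightarrow> j < n \<Longrightarrow> D $$ (i, j) = (if j = \<pi> i then d (c i) else 0)"
    and A_entry: "\<And>i j. i < n \<Longrightarrow> j < n \<Longrightarrow> A $$ (i, j) = D $$ (i, j) + C (c i) (c j)"
    and N: "\<And>q. q < k \<Longrightarrow> card {j. j < n \<and> c j = q} = N q"
  shows "char_poly A * (\<Prod>p<k. [:- d p, 1:]) = char_poly D *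
    char_poly (mat k k (\<lambda>(p, q). (if p = q then d p else 0) + C p q * of_nat (N q)))"
proof -
  let ?U = "mat n k (\<lambda>(i, p). if c i = p then 1 else 0 :: 'a)"
  let ?W = "mat k n (\<lambda>(p, j). C p (c j))"
  let ?S = "mat k k (\<lambda>(p, q). if p = q then d p else 0)"
  have "A = D + ?U * ?W"
  proof (rule eq_matI)
    fix i j assume "i < dim_row (D + ?U * ?W)" "j < dim_col (D + ?U * ?W)"
    then have ij: "i < n" "j < n" using D by auto
    have "(?U * ?W) $$ (i, j) = (\<Sum>p<k. (if c i = p then 1 else 0) * C p (c j))"
      using ij by (auto simp: scalar_prod_def atLeast0LessThan intro!: sum.cong)
    also have "\<dots> = C (c i) (c j)" using c[OF ij(1)]
      by (simp add: if_distrib[of "\<lambda>x. x * _"] cong: if_cong)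
    finally show "A $$ (i, j) = (D + ?U * ?W) $$ (i, j)" using ij D by (simp add: A_entry)
  qed (use A D in auto)
  moreover have "D * ?U = ?U * ?S"
  proof (rule eq_matI)
    fix i q assume "i < dim_row (?U * ?S)" "q < dim_col (?U * ?S)"
    then have iq: "i < n" "q < k" by auto
    have "(D * ?U) $$ (i, q) = (\<Sum>j<n. D $$ (i, j) * (if c j = q then 1 else 0))"
      using iq D by (auto simp: scalar_prod_def atLeast0LessThan intro!: sum.cong)
    \<comment> \<open>Row \<open>i\<close> of \<open>D\<close> is supported in column
      \<open>\<pi> i\<close>, which lies in the same cell as \<open>i\<close>.\<close>
    also have "\<dots> = (\<Sum>j<n. if j = \<pi> i then d (c i) * (if c j = q then 1 else 0) else 0)"
      using iq by (intro sum.cong) (auto simp: D_entry)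
    also have "\<dots> = (if c i = q then d q else 0)"
      using \<pi>[OF iq(1)] by simp
    \<comment> \<open>Reinserts a sum over cells: row \<open>i\<close> of \<open>?U\<close> is the
      unit vector at \<open>c i\<close>.\<close>
    also have "\<dots> = (\<Sum>p<k. if p = c i then (if p = q then d p else 0) else 0)"
      using c[OF iq(1)] by simp
    also have "\<dots> = (?U * ?S) $$ (i, q)"
      using iq by (auto simp: scalar_prod_def atLeast0LessThan
          simp del: sum.delta sum.delta' intro!: sum.cong)
    finally show "(D * ?U) $$ (i, q) = (?U * ?S) $$ (i, q)" .
  qed (use D in auto)
  moreover have "?S + ?W * ?U =
    mat k k (\<lambda>(p, q). (if p = q then d p else 0) + C p q * of_nat (N q))"
  proof (rule eq_matI, goal_cases)
    case (1 p q)
    then have pq: "p < k" "q < k" by auto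
    have "(?W * ?U) $$ (p, q) = (\<Sum>j<n. C p (c j) * (if c j = q then 1 else 0))"
      using pq by (auto simp: scalar_prod_def atLeast0LessThan intro!: sum.cong)
    \<comment> \<open>Column \<open>q\<close> of \<open>?U\<close> is the indicator of cell
      \<open>q\<close>, on which the summand is constant.\<close>
    also have "\<dots> = (\<Sum>j | j < n \<and> c j = q. C p q)"
      by (intro sum.mono_neutral_cong_right) auto
    also have "\<dots> = C p q * of_nat (N q)" using N[OF pq(2)] by simp
    finally show ?case using pq by simp
  qed auto
  ultimately show ?thesis
    using char_poly_mult_char_poly_intertwined[of D n ?U k ?W ?S A] D
    by (simp add: char_poly_diag)
qed

section \<open>Determinants of order up to four\<close>

lemma det_2_by_2:
  fixes A :: "'a :: comm_ring_1 mat"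
  assumes "A \<in> carrier_mat 2 2"
  shows "det A = A $$ (0,0) * A $$ (1,1) - A $$ (0,1) * A $$ (1,0)"
  using assms
  by (simp add: laplace_expansion_row[of A 2 0] numeral_2_eq_2 lessThan_Suc
      cofactor_def mat_delete_def det_single)

lemma det_3_by_3:
  fixes A :: "'a :: comm_ring_1 mat"
  assumes "A \<in> carrier_mat 3 3"
  shows "det A =
    A $$ (0,0) * (A $$ (1,1) * A $$ (2,2) - A $$ (1,2) * A $$ (2,1)) -
    A $$ (0,1) * (A $$ (1,0) * A $$ (2,2) - A $$ (1,2) * A $$ (2,0)) +
    A $$ (0,2) * (A $$ (1,0) * A $$ (2,1) - A $$ (1,1) * A $$ (2,0))"
  using assms
  by (simp add: laplace_expansion_row[of A 3 0] numeral_3_eq_3 numeral_2_eq_2 lessThan_Suc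
      cofactor_def mat_delete_def det_2_by_2[unfolded numeral_2_eq_2] algebra_simps)

text \<open>Laplace expansion along row 0; \<open>minor p q r\<close> is the minor on rows 1, 2, 3
  and columns \<open>p\<close>, \<open>q\<close>, \<open>r\<close>.\<close>

lemma det_4_by_4:
  fixes A :: "'a :: comm_ring_1 mat"
  assumes "A \<in> carrier_mat 4 4"
  defines "minor \<equiv> \<lambda>p q r. A $$ (1,p) * (A $$ (2,q) * A $$ (3,r) - A $$ (2,r) * A $$ (3,q)) -
    A $$ (1,q) * (A $$ (2,p) * A $$ (3,r) - A $$ (2,r) * A $$ (3,p)) +
    A $$ (1,r) * (A $$ (2,p) * A $$ (3,q) - A $$ (2,q) * A $$ (3,p))"
  shows "det A = A $$ (0,0) * minor 1 2 3 - A $$ (0,1) * minor 0 2 3 +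
    A $$ (0,2) * minor 0 1 3 - A $$ (0,3) * minor 0 1 2"
  using assms(1) unfolding minor_def
  by (simp add: laplace_expansion_row[of A 4 0] eval_nat_numeral lessThan_Suc
      cofactor_def mat_delete_def det_3_by_3[unfolded eval_nat_numeral] algebra_simps)

section \<open>Characteristic polynomials of signed reverse identities and scalar matrices\<close>

text \<open>Cut into blocks of order \<open>l\<close>, \<open>x I - s R\<close> has
  \<open>x I\<close> on the diagonal and \<open>B = - s R\<close> off it. The blocks commute, so the
  determinant is that of \<open>x^2 I - B^2 = (x^2 - 1) I\<close>. The sign \<open>s\<close> drops
  out.\<close>

lemma char_poly_smult_rev_id_mat:
  assumes s: "s * s = 1"
  shows "char_poly (s \<cdot>\<^sub>m rev_id_mat (2 * l)) = [:-1, 1:] ^ l * [:1, 1:] ^ l"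
proof -
  let ?X = "[:0, 1:] \<cdot>\<^sub>m 1\<^sub>m l :: real poly mat"
  let ?B = "mat l l (\<lambda>(i, j). if i + j + 1 = l then [:- s:] else 0)"
  have X: "?X \<in> carrier_mat l l" and B: "?B \<in> carrier_mat l l" by auto
  have block: "char_poly_matrix (s \<cdot>\<^sub>m rev_id_mat (2 * l)) = four_block_mat ?X ?B ?B ?X"
    by (rule eq_matI) (auto simp: char_poly_matrix_def rev_id_mat_def)
  have XX: "?X * ?X = ([:0, 1:] * [:0, 1:]) \<cdot>\<^sub>m 1\<^sub>m l"
    by (intro eq_matI) (auto simp: mult_smult_assoc_mat[of _ l l])
  have BB: "?B * ?B = 1\<^sub>m l"
  proof (rule eq_matI)
    fix i j assume "i < dim_row (1\<^sub>m l)" "j < dim_col (1\<^sub>m l)"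
    then have ij: "i < l" "j < l" by auto
    have "(?B * ?B) $$ (i, j) = (\<Sum>p<l. ?B $$ (i, p) * ?B $$ (p, j))"
      using ij by (simp add: scalar_prod_def atLeast0LessThan)
    \<comment> \<open>Row \<open>i\<close> of \<open>?B\<close> is supported at
      \<open>l - 1 - i\<close>, and the product of the two entries is
      \<open>s * s = 1\<close>.\<close>
    also have "\<dots> = (\<Sum>p<l. if p = l - 1 - i then if i = j then 1 else 0 else 0)"
      using ij s by (intro sum.cong) auto
    also have "\<dots> = 1\<^sub>m l $$ (i, j)" using ij by simp
    finally show "(?B * ?B) $$ (i, j) = 1\<^sub>m l $$ (i, j)" .
  qed auto
  have "?B * ?X = ?X * ?B"
    using mult_smult_distrib[OF B one_carrier_mat] mult_smult_assoc_mat[OF one_carrier_mat B] B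
    by simp
  from det_four_block_mat[OF X B B X this]
  have "char_poly (s \<cdot>\<^sub>m rev_id_mat (2 * l)) = det (?X * ?X - ?B * ?B)"
    unfolding char_poly_def block .
  also have "?X * ?X - ?B * ?B = ([:-1, 1:] * [:1, 1:]) \<cdot>\<^sub>m 1\<^sub>m l"
    unfolding XX BB by (intro eq_matI) auto
  also have "det \<dots> = [:-1, 1:] ^ l * [:1, 1:] ^ l"
    by (simp add: det_smult power_mult_distrib del: mult_pCons_left mult_pCons_right)
  finally show ?thesis .
qed

lemma char_poly_smult_one_mat: "char_poly (s \<cdot>\<^sub>m 1\<^sub>m n) = [:- s, 1:] ^ n"
  for s :: "'a :: comm_ring_1"
proof -
  have "char_poly_matrix (s \<cdot>\<^sub>m 1\<^sub>m n) = [:- s, 1:] \<cdot>\<^sub>m 1\<^sub>m n"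
    by (rule eq_matI) (auto simp: char_poly_matrix_def)
  then show ?thesis by (simp add: char_poly_def det_smult)
qed

section \<open>Signed graphs from symmetric matrices\<close>

text \<open>The vertices are the indices, the edges are the positions of nonzero entries, and the
  sign of an edge is its entry. The zero diagonal excludes loops.\<close>

lemma is_signed_graph_adjacency_matI:
  assumes A: "A \<in> carrier_mat n n"
    and sym: "\<And>i j. i < n \<Longrightarrow> j < n \<Longrightarrow> A $$ (i, j) = A $$ (j, i)"
    and diag: "\<And>i. i < n \<Longrightarrow> A $$ (i, i) = 0"
    and entries: "\<And>i j. i < n \<Longrightarrow> j < n \<Longrightarrow> A $$ (i, j) \<in> {-1, 0, 1}"
  shows "is_signed_graph_adjacency_mat A"
proof -
  define E where "E = {{i, j} |i j. i < n \<and> j < n \<and> A $$ (i, j) \<noteq> 0}"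
  \<comment> \<open>\<open>Min\<close> and \<open>Max\<close> recover an ordered pair from the edge,
    harmless by symmetry; the floor turns the real entry into an integer.\<close>
  define \<sigma> where "\<sigma> e = \<lfloor>A $$ (Min e, Max e)\<rfloor>" for e
  have \<sigma>: "\<sigma> {i, j} = \<lfloor>A $$ (i, j)\<rfloor>" if "i < n" "j < n" for i j
    using sym[OF that] by (cases "i \<le> j") (auto simp: \<sigma>_def min_def max_def)
  have E: "{i, j} \<in> E \<longleftrightarrow> A $$ (i, j) \<noteq> 0" if "i < n" "j < n" for i j
    using sym[OF that] that by (fastforce simp: E_def doubleton_eq_iff)
  have floor: "\<lfloor>- 1 :: real\<rfloor> = -1" by (rule floor_unique) auto
  have graph: "signed_graph (set [0..<n]) E \<sigma>"
    unfolding signed_graph_def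
  proof (intro conjI ballI subsetI)
    fix e assume "e \<in> E"
    then obtain i j where e: "e = {i, j}" "i < n" "j < n" "A $$ (i, j) \<noteq> 0"
      by (auto simp: E_def)
    with diag have "i \<noteq> j" by auto
    with e show "e \<in> {e. e \<subseteq> set [0..<n] \<and> card e = 2}" by auto
    show "\<sigma> e \<in> {-1, 1}" using entries[OF e(2,3)] e \<sigma> floor by auto
  qed auto
  have "A = signed_adjacency_mat [0..<n] E \<sigma>"
  proof (rule eq_matI)
    fix i j
    assume "i < dim_row (signed_adjacency_mat [0..<n] E \<sigma>)"
      "j < dim_col (signed_adjacency_mat [0..<n] E \<sigma>)"
    then have ij: "i < n" "j < n" by (auto simp: signed_adjacency_mat_def)
    show "A $$ (i, j) = signed_adjacency_mat [0..<n] E \<sigma> $$ (i, j)"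
      using entries[OF ij] ij by (auto simp: signed_adjacency_mat_def E \<sigma> floor)
  qed (use A in \<open>auto simp: signed_adjacency_mat_def\<close>)
  with graph show ?thesis
    unfolding is_signed_graph_adjacency_mat_def by (metis distinct_upt)
qed

section \<open>From polynomial identities to eigenvalue multisets\<close>

text \<open>Cancels \<open>char_poly S\<close>, a product of powers of \<open>x + 1\<close> and
  \<open>x - 1\<close>. Writing the exponents as \<open>c + a\<close> and \<open>d + b\<close>
  avoids truncated subtraction.\<close>

lemma proots_cancel_pm_one:
  assumes "p * ([:1, 1:] ^ a * [:-1, 1:] ^ b) =
    [:1, 1:] ^ (c + a) * [:-1, 1:] ^ (d + b) * ([:- x, 1:] * [:- y, 1:])"
  shows "proots p = replicate_mset c (-1 :: real) + replicate_mset d 1 + {#x, y#}"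
proof -
  have "p * ([:1, 1:] ^ a * [:-1, 1:] ^ b) =
    ([:1, 1:] ^ c * [:-1, 1:] ^ d * ([:- x, 1:] * [:- y, 1:])) * ([:1, 1:] ^ a * [:-1, 1:] ^ b)"
    unfolding assms power_add by (simp only: mult_ac)
  moreover have "[:1, 1:] ^ a * [:-1, 1:] ^ b \<noteq> (0 :: real poly)" by simp
  ultimately have "p = [:1, 1:] ^ c * [:-1, 1:] ^ d * ([:- x, 1:] * [:- y, 1:])"
    using mult_right_cancel by blast
  then show ?thesis
    by (simp add: proots_mult proots_power del: mult_pCons_left mult_pCons_right)
qed

text \<open>Vieta: the two roots have sum \<open>s\<close> and product
  \<open>(s^2 - d) / 4\<close>.\<close>

lemma quadratic_factors:
  fixes s :: real
  assumes "d \<ge> 0"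
  shows "[:- ((s + sqrt d) / 2), 1:] * [:- ((s - sqrt d) / 2), 1:] = [:(s\<^sup>2 - d) / 4, - s, 1:]"
  using assms by (simp add: field_simps power2_eq_square)

text \<open>The filter discards all the replicated elements, so only \<open>x\<close> and
  \<open>y\<close> can survive.\<close>

lemma size_filter_le_two:
  "size {#z \<in># replicate_mset a (-1) + replicate_mset b 1 + {#x, y#}. z \<noteq> 1 \<and> z \<noteq> (-1 :: real)#} \<le> 2"
proof -
  have "{#z \<in># replicate_mset a (-1) + replicate_mset b 1 + {#x, y#}. z \<noteq> 1 \<and> z \<noteq> (-1 :: real)#}
    = {#z \<in># {#x, y#}. z \<noteq> 1 \<and> z \<noteq> -1#}" by (rule multiset_eqI) auto
  then show ?thesis using size_filter_mset_lesseq[of _ "{#x, y#}"] by simp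
qed

section \<open>Block diagonal matrices, dimensions and index cases\<close>

lemma char_poly_block_diag:
  fixes A :: "'a :: idom mat"
  assumes "A \<in> carrier_mat n n" and "D \<in> carrier_mat k k"
  shows "char_poly (four_block_mat A (0\<^sub>m n k) (0\<^sub>m k n) D) = char_poly A * char_poly D"
  using char_poly_four_block_upper_right_zero[OF assms(1) _ assms(2)] by simp

lemma char_poly_block4_diag:
  fixes A :: "'a :: idom mat"
  assumes "A \<in> carrier_mat a a" "B \<in> carrier_mat b b" "C \<in> carrier_mat c c" "D \<in> carrier_mat d d"
  shows "char_poly (block4_mat
      A (0\<^sub>m a b) (0\<^sub>m a c) (0\<^sub>m a d)
      (0\<^sub>m b a) B (0\<^sub>m b c) (0\<^sub>m b d)
      (0\<^sub>m c a) (0\<^sub>m c b) C (0\<^sub>m c d)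
      (0\<^sub>m d a) (0\<^sub>m d b) (0\<^sub>m d c) D) =
    char_poly A * char_poly B * char_poly C * char_poly D"
proof -
  let ?F = "four_block_mat A (0\<^sub>m a b) (0\<^sub>m b a) B"
  let ?G = "four_block_mat C (0\<^sub>m c d) (0\<^sub>m d c) D"
  have "?F \<in> carrier_mat (a + b) (a + b)" "?G \<in> carrier_mat (c + d) (c + d)"
    by (rule four_block_carrier_mat[OF assms(1,2)], rule four_block_carrier_mat[OF assms(3,4)])
  \<comment> \<open>The off-diagonal corners are zero matrices assembled from four zero blocks, so
    the two-block case applies outside and then inside.\<close>
  from char_poly_block_diag[OF this] show ?thesis
    unfolding block4_mat_def four_block_zero_mat char_poly_block_diag[OF assms(1,2)]
      char_poly_block_diag[OF assms(3,4)] by (simp only: mult.assoc)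
qed

lemma A1_carrier: "A1 m l \<in> carrier_mat (m + 2 * l) (m + 2 * l)"
  by (rule carrier_matI) (simp_all add: A1_def ones_mat_def rev_id_mat_def)

lemma A2_carrier: "A2 m l \<in> carrier_mat (2 * m + 2 * l) (2 * m + 2 * l)"
  by (rule carrier_matI) (simp_all add: A2_def ones_mat_def rev_id_mat_def)

lemma A3_carrier: "A3 m l \<in> carrier_mat (m + 1 + 1 + l) (m + 1 + 1 + l)"
  by (rule carrier_matI) (simp_all add: A3_def block4_mat_def ones_mat_def)

lemma A4_carrier: "A4 m l \<in> carrier_mat (m + 2 + 2 + l) (m + 2 + 2 + l)"
  by (rule carrier_matI) (simp_all add: A4_def block4_mat_def ones_mat_def rev_id_mat_def)

lemma less_4_cases: "q < 4 \<Longrightarrow> q = 0 \<or> q = 1 \<or> q = 2 \<or> q = (3 :: nat)"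
  by auto

text \<open>The cells of size 2 are listed index by index, so that simplification can evaluate the
  entries of \<open>rev_id_mat 2\<close>.\<close>

lemma A4_index_cases:
  fixes i m l :: nat
  assumes "i < m + 2 + 2 + l"
  shows "i < m \<or> i = m \<or> i = m + 1 \<or> i = m + 2 \<or> i = m + 3 \<or> (\<exists>k. i = m + 4 + k \<and> k < l)"
  using assms by presburger

section \<open>The four spectra\<close>

text \<open>The blocks \<open>-I\<close> and \<open>-R\<close> of \<open>?D\<close> both have row
  sum -1, so \<open>char_poly S\<close> is \<open>(x + 1)^2\<close>. The quotient matrix, with rows
  \<open>(m - 1, 2 l)\<close> and \<open>(m, -1)\<close>, gives the last two eigenvalues.\<close>

lemma A1_eigenvalues:
  assumes "m \<ge> 1" "l \<ge> 1"
  shows "eigenvalues_mset (A1 m l) =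
    replicate_mset (l + m - 2) (-1) + replicate_mset l 1 +
      {# (real m - 2 + sqrt (real m * (real m + 8 * real l))) / 2,
         (real m - 2 - sqrt (real m * (real m + 8 * real l))) / 2 #}"
proof -
  let ?D = "four_block_mat ((-1) \<cdot>\<^sub>m 1\<^sub>m m) (0\<^sub>m m (2 * l))
    (0\<^sub>m (2 * l) m) ((-1) \<cdot>\<^sub>m rev_id_mat (2 * l))"
  let ?C = "\<lambda>p q. [[1, 1], [1, 0 :: real]] ! p ! q"
  let ?N = "\<lambda>q. [m, 2 * l] ! q"
  define c :: "nat \<Rightarrow> nat" where "c i = (if i < m then 0 else 1)" for i
  \<comment> \<open>Reverses the second block, whose indices run from \<open>m\<close> to
    \<open>m + 2 * l - 1\<close>.\<close>
  define \<pi> where "\<pi> i = (if i < m then i else 2 * m + 2 * l - 1 - i)" for i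
  let ?Q = "mat 2 2 (\<lambda>(p, q). (if p = q then -1 else 0) + ?C p q * real (?N q))"
  have R: "rev_id_mat (2 * l) \<in> carrier_mat (2 * l) (2 * l)" by (simp add: rev_id_mat_def)
  have N: "card {j. j < m + 2 * l \<and> c j = q} = ?N q" if "q < 2" for q
  proof -
    have "{j. j < m + 2 * l \<and> c j = 0} = {0..<m}"
      "{j. j < m + 2 * l \<and> c j = 1} = {m..<m + 2 * l}"
      by (auto simp: c_def)
    with less_2_cases[OF that] show ?thesis by (elim disjE) simp_all
  qed
  have D: "?D \<in> carrier_mat (m + 2 * l) (m + 2 * l)"
    by (rule carrier_matI) (simp_all add: rev_id_mat_def)
  have "char_poly (A1 m l) * (\<Prod>p<2::nat. [:- (-1), 1:]) = char_poly ?D * char_poly ?Q"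
  proof (rule char_poly_equitable_partition[where c = c and \<pi> = \<pi> and d = "\<lambda>_. -1",
        OF A1_carrier D])
    fix i j assume ij: "i < m + 2 * l" "j < m + 2 * l"
    show "?D $$ (i, j) = (if j = \<pi> i then -1 else 0)"
      using ij by (cases "i < m"; cases "j < m") (auto simp: c_def \<pi>_def rev_id_mat_def)
    show "A1 m l $$ (i, j) = ?D $$ (i, j) + ?C (c i) (c j)"
      using ij by (cases "i < m"; cases "j < m")
        (auto simp: c_def A1_def ones_mat_def rev_id_mat_def)
  qed (use N in \<open>auto simp: c_def \<pi>_def\<close>)
  moreover have "char_poly ?D = [:1, 1:] ^ m * ([:-1, 1:] ^ l * [:1, 1:] ^ l)"
    using R by (simp add: char_poly_block_diag char_poly_smult_one_mat char_poly_smult_rev_id_mat)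
  moreover have "char_poly ?Q = [:1 - real m - 2 * real m * real l, 2 - real m, 1:]"
    by (simp add: char_poly_def det_2_by_2 char_poly_matrix_def algebra_simps)
  \<comment> \<open>The lower bounds on \<open>m\<close> and \<open>l\<close> make the truncated
    subtraction exact.\<close>
  moreover have "l + m - 2 + 2 = l + m" using assms by simp
  ultimately have "char_poly (A1 m l) * ([:1, 1:] ^ 2 * [:-1, 1:] ^ 0) =
    [:1, 1:] ^ (l + m - 2 + 2) * [:-1, 1:] ^ (l + 0) *
      [:1 - real m - 2 * real m * real l, 2 - real m, 1:]"
    by (simp only: power_add mult_ac prod_constant card_lessThan power_one_right power_0
        mult_1_right minus_minus add_0_right)
  also have "[:1 - real m - 2 * real m * real l, 2 - real m, 1:] =
    [:- ((real m - 2 + sqrt (real m * (real m + 8 * real l))) / 2), 1:] *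
    [:- ((real m - 2 - sqrt (real m * (real m + 8 * real l))) / 2), 1:]"
    by (subst quadratic_factors) (auto simp: power2_eq_square field_simps)
  finally show ?thesis
    unfolding eigenvalues_mset_def by (rule proots_cancel_pm_one)
qed

text \<open>The blocks \<open>R\<close> and \<open>-R\<close> of \<open>?D\<close> have row sums 1
  and -1, so \<open>char_poly S\<close> removes one copy of each from the spectrum of
  \<open>?D\<close>. The quotient matrix has rows \<open>(1, 2 l)\<close> and
  \<open>(2 m, -1)\<close>.\<close>

lemma A2_eigenvalues:
  assumes "m \<ge> 1" "l \<ge> 1"
  shows "eigenvalues_mset (A2 m l) =
    replicate_mset (m + l - 1) (-1) + replicate_mset (m + l - 1) 1 +
      {# sqrt (1 + 4 * real m * real l), - sqrt (1 + 4 * real m * real l) #}"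
proof -
  let ?D = "four_block_mat (1 \<cdot>\<^sub>m rev_id_mat (2 * m)) (0\<^sub>m (2 * m) (2 * l))
    (0\<^sub>m (2 * l) (2 * m)) ((-1) \<cdot>\<^sub>m rev_id_mat (2 * l))"
  let ?d = "\<lambda>p. [1, -1 :: real] ! p"
  let ?C = "\<lambda>p q. [[0, 1], [1, 0 :: real]] ! p ! q"
  let ?N = "\<lambda>q. [2 * m, 2 * l] ! q"
  define c :: "nat \<Rightarrow> nat" where "c i = (if i < 2 * m then 0 else 1)" for i
  define \<pi> where "\<pi> i = (if i < 2 * m then 2 * m - 1 - i else 4 * m + 2 * l - 1 - i)" for i
  let ?Q = "mat 2 2 (\<lambda>(p, q). (if p = q then ?d p else 0) + ?C p q * real (?N q))"
  have R: "rev_id_mat (2 * k) \<in> carrier_mat (2 * k) (2 * k)" for k by (simp add: rev_id_mat_def)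
  have N: "card {j. j < 2 * m + 2 * l \<and> c j = q} = ?N q" if "q < 2" for q
  proof -
    have "{j. j < 2 * m + 2 * l \<and> c j = 0} = {0..<2 * m}"
      "{j. j < 2 * m + 2 * l \<and> c j = 1} = {2 * m..<2 * m + 2 * l}"
      by (auto simp: c_def)
    with less_2_cases[OF that] show ?thesis by (elim disjE) simp_all
  qed
  have D: "?D \<in> carrier_mat (2 * m + 2 * l) (2 * m + 2 * l)"
    by (rule carrier_matI) (simp_all add: rev_id_mat_def)
  have "char_poly (A2 m l) * (\<Prod>p<2. [:- ?d p, 1:]) = char_poly ?D * char_poly ?Q"
  proof (rule char_poly_equitable_partition[where c = c and \<pi> = \<pi>, OF A2_carrier D])
    fix i j assume ij: "i < 2 * m + 2 * l" "j < 2 * m + 2 * l"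
    show "?D $$ (i, j) = (if j = \<pi> i then ?d (c i) else 0)"
      using ij by (cases "i < 2 * m"; cases "j < 2 * m") (auto simp: c_def \<pi>_def rev_id_mat_def)
    show "A2 m l $$ (i, j) = ?D $$ (i, j) + ?C (c i) (c j)"
      using ij by (cases "i < 2 * m"; cases "j < 2 * m")
        (auto simp: c_def A2_def ones_mat_def rev_id_mat_def)
  qed (use N in \<open>auto simp: c_def \<pi>_def\<close>)
  moreover have "(\<Prod>p<2. [:- ?d p, 1:]) = [:1, 1:] * [:-1, 1:]"
    by (simp add: numeral_2_eq_2)
  moreover have "char_poly ?D = ([:-1, 1:] ^ m * [:1, 1:] ^ m) * ([:-1, 1:] ^ l * [:1, 1:] ^ l)"
    using R by (simp add: char_poly_block_diag char_poly_smult_rev_id_mat)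
  moreover have "char_poly ?Q = [:- 1 - 4 * real m * real l, 0, 1:]"
    by (simp add: char_poly_def det_2_by_2 char_poly_matrix_def algebra_simps)
  moreover have "m + l - 1 + 1 = m + l" using assms by simp
  ultimately have "char_poly (A2 m l) * ([:1, 1:] ^ 1 * [:-1, 1:] ^ 1) =
    [:1, 1:] ^ (m + l - 1 + 1) * [:-1, 1:] ^ (m + l - 1 + 1) * [:- 1 - 4 * real m * real l, 0, 1:]"
    by (simp only: power_add mult_ac prod_constant card_lessThan power_one_right power_0
        mult_1_right minus_minus add_0_right)
  also have "[:- 1 - 4 * real m * real l, 0, 1:] =
    [:- sqrt (1 + 4 * real m * real l), 1:] * [:- (- sqrt (1 + 4 * real m * real l)), 1:]"
    by simp
  finally show ?thesis
    unfolding eigenvalues_mset_def by (rule proots_cancel_pm_one)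
qed

text \<open>\<open>?D\<close> contributes -1 with multiplicity \<open>m + 1\<close> and 1 with
  multiplicity \<open>l + 1\<close>. The quotient matrix adds one of each together with
  \<open>-l - 1\<close> and \<open>m + 1\<close>, and \<open>char_poly S\<close> removes two of each
  sign.\<close>

lemma A3_eigenvalues:
  "eigenvalues_mset (A3 m l) =
    replicate_mset m (-1) + replicate_mset l 1 + {# - real l - 1, real m + 1 #}"
proof -
  let ?D = "block4_mat
    ((-1 :: real) \<cdot>\<^sub>m 1\<^sub>m m) (0\<^sub>m m 1) (0\<^sub>m m 1) (0\<^sub>m m l)
    (0\<^sub>m 1 m) (1 \<cdot>\<^sub>m 1\<^sub>m 1) (0\<^sub>m 1 1) (0\<^sub>m 1 l)
    (0\<^sub>m 1 m) (0\<^sub>m 1 1) ((-1) \<cdot>\<^sub>m 1\<^sub>m 1) (0\<^sub>m 1 l)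
    (0\<^sub>m l m) (0\<^sub>m l 1) (0\<^sub>m l 1) (1 \<cdot>\<^sub>m 1\<^sub>m l)"
  \<comment> \<open>The zero diagonal entries of the two singleton cells are split as \<open>1 + (-1)\<close> and
    \<open>(-1) + 1\<close>, so that \<open>D\<close> has no eigenvalue 0.\<close>
  let ?d = "\<lambda>p. [-1, 1, -1, 1 :: real] ! p"
  let ?C = "\<lambda>p q. [[1, 1, 1, 0], [1, -1, 1, -1], [1, 1, 1, 1], [0, -1, 1, -1 :: real]] ! p ! q"
  let ?N = "\<lambda>q. [m, 1, 1, l] ! q"
  define c :: "nat \<Rightarrow> nat" where
    "c i = (if i < m then 0 else if i < m + 1 then 1 else if i < m + 2 then 2 else 3)" for i
  let ?Q = "mat 4 4 (\<lambda>(p, q). (if p = q then ?d p else 0) + ?C p q * real (?N q))"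
  have N: "card {j. j < m + 1 + 1 + l \<and> c j = q} = ?N q" if "q < 4" for q
  proof -
    have "{j. j < m + 1 + 1 + l \<and> c j = q} =
      [{0..<m}, {m..<m + 1}, {m + 1..<m + 2}, {m + 2..<m + 2 + l}] ! q"
      using less_4_cases[OF that] by (auto simp: c_def split: if_splits)
    with less_4_cases[OF that] show ?thesis by (elim disjE) simp_all
  qed
  have D: "?D \<in> carrier_mat (m + 1 + 1 + l) (m + 1 + 1 + l)"
    by (rule carrier_matI) (simp_all add: block4_mat_def)
  have "char_poly (A3 m l) * (\<Prod>p<4. [:- ?d p, 1:]) = char_poly ?D * char_poly ?Q"
  \<comment> \<open>Here \<open>?D\<close> is diagonal, so the permutation is the identity.\<close>
  proof (rule char_poly_equitable_partition[where c = c and \<pi> = id, OF A3_carrier D])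
    fix i j assume ij: "i < m + 1 + 1 + l" "j < m + 1 + 1 + l"
    show "?D $$ (i, j) = (if j = id i then ?d (c i) else 0)"
      using ij by (auto simp: c_def block4_mat_def)
    show "A3 m l $$ (i, j) = ?D $$ (i, j) + ?C (c i) (c j)"
      using ij by (auto simp: c_def block4_mat_def A3_def ones_mat_def)
  qed (use N in \<open>auto simp: c_def\<close>)
  moreover have "(\<Prod>p<4. [:- ?d p, 1:]) = [:1, 1:] ^ 2 * [:-1, 1:] ^ 2"
    by (simp add: eval_nat_numeral)
  moreover have "char_poly ?D = [:1, 1:] ^ m * [:-1, 1:] ^ 1 * [:1, 1:] ^ 1 * [:-1, 1:] ^ l"
    by (subst char_poly_block4_diag) (auto simp: char_poly_smult_one_mat)
  moreover have "char_poly ?Q = [:1, 1:] * [:-1, 1:] * ([:- (- real l - 1), 1:] * [:- (real m + 1), 1:])"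
    by (simp add: char_poly_def det_4_by_4 char_poly_matrix_def algebra_simps)
  ultimately have "char_poly (A3 m l) * ([:1, 1:] ^ 2 * [:-1, 1:] ^ 2) =
    [:1, 1:] ^ (m + 2) * [:-1, 1:] ^ (l + 2) * ([:- (- real l - 1), 1:] * [:- (real m + 1), 1:])"
    by (simp add: power_add power2_eq_square mult_ac del: mult_pCons_left mult_pCons_right)
  then show ?thesis
    unfolding eigenvalues_mset_def by (rule proots_cancel_pm_one)
qed


text \<open>Each block \<open>R\<close> or \<open>-R\<close> of order 2 contributes both 1 and -1,
  so \<open>?D\<close> has -1 with multiplicity \<open>m + 2\<close> and 1 with multiplicity
  \<open>l + 2\<close>. The quotient matrix adds one of each and the roots of a quadratic;
  \<open>char_poly S\<close> removes two of each.\<close>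

lemma A4_eigenvalues:
  "eigenvalues_mset (A4 m l) =
    replicate_mset (m + 1) (-1) + replicate_mset (l + 1) 1 +
      {# (real m - real l + sqrt (real m ^ 2 + real l ^ 2 + 6 * real m * real l
            + 4 * real m + 4 * real l + 4)) / 2,
         (real m - real l - sqrt (real m ^ 2 + real l ^ 2 + 6 * real m * real l
            + 4 * real m + 4 * real l + 4)) / 2 #}"
proof -
  let ?D = "block4_mat
    ((-1 :: real) \<cdot>\<^sub>m 1\<^sub>m m) (0\<^sub>m m 2) (0\<^sub>m m 2) (0\<^sub>m m l)
    (0\<^sub>m 2 m) (1 \<cdot>\<^sub>m rev_id_mat 2) (0\<^sub>m 2 2) (0\<^sub>m 2 l)
    (0\<^sub>m 2 m) (0\<^sub>m 2 2) ((-1) \<cdot>\<^sub>m rev_id_mat 2) (0\<^sub>m 2 l)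
    (0\<^sub>m l m) (0\<^sub>m l 2) (0\<^sub>m l 2) (1 \<cdot>\<^sub>m 1\<^sub>m l)"
  let ?d = "\<lambda>p. [-1, 1, -1, 1 :: real] ! p"
  let ?C = "\<lambda>p q. [[1, 1, 0, 1], [1, 0, 0, 0], [0, 0, 0, -1], [1, 0, -1, -1 :: real]] ! p ! q"
  let ?N = "\<lambda>q. [m, 2, 2, l] ! q"
  define c :: "nat \<Rightarrow> nat" where
    "c i = (if i < m then 0 else if i < m + 2 then 1 else if i < m + 4 then 2 else 3)" for i
  \<comment> \<open>Swaps the two indices within each of the middle cells.\<close>
  define \<pi> where "\<pi> i = (if i < m then i else if i < m + 2 then 2 * m + 1 - i
    else if i < m + 4 then 2 * m + 5 - i else i)" for i
  let ?Q = "mat 4 4 (\<lambda>(p, q). (if p = q then ?d p else 0) + ?C p q * real (?N q))"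
  have N: "card {j. j < m + 2 + 2 + l \<and> c j = q} = ?N q" if "q < 4" for q
  proof -
    have "{j. j < m + 2 + 2 + l \<and> c j = q} =
      [{0..<m}, {m..<m + 2}, {m + 2..<m + 4}, {m + 4..<m + 4 + l}] ! q"
      using less_4_cases[OF that] by (auto simp: c_def split: if_splits)
    with less_4_cases[OF that] show ?thesis by (elim disjE) simp_all
  qed
  have D: "?D \<in> carrier_mat (m + 2 + 2 + l) (m + 2 + 2 + l)"
    by (rule carrier_matI) (simp_all add: block4_mat_def rev_id_mat_def)
  have "char_poly (A4 m l) * (\<Prod>p<4. [:- ?d p, 1:]) = char_poly ?D * char_poly ?Q"
  proof (rule char_poly_equitable_partition[where c = c and \<pi> = \<pi>, OF A4_carrier D])
    fix i j assume ij: "i < m + 2 + 2 + l" "j < m + 2 + 2 + l"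
    show "?D $$ (i, j) = (if j = \<pi> i then ?d (c i) else 0)"
      using A4_index_cases[OF ij(1)] A4_index_cases[OF ij(2)]
      by (elim disjE exE conjE) (simp_all add: c_def \<pi>_def block4_mat_def rev_id_mat_def)
    show "A4 m l $$ (i, j) = ?D $$ (i, j) + ?C (c i) (c j)"
      using A4_index_cases[OF ij(1)] A4_index_cases[OF ij(2)]
      by (elim disjE exE conjE)
        (simp_all add: c_def block4_mat_def A4_def ones_mat_def rev_id_mat_def)
  qed (use N in \<open>auto simp: c_def \<pi>_def\<close>)
  moreover have "(\<Prod>p<4. [:- ?d p, 1:]) = [:1, 1:] ^ 2 * [:-1, 1:] ^ 2"
    by (simp add: eval_nat_numeral)
  moreover have "char_poly ?D = [:1, 1:] ^ m * ([:-1, 1:] ^ 1 * [:1, 1:] ^ 1) *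
    ([:-1, 1:] ^ 1 * [:1, 1:] ^ 1) * [:-1, 1:] ^ l"
    \<comment> \<open>The blocks of order 2 are the case \<open>l = 1\<close>, with signs 1 and
      -1.\<close>
    using char_poly_smult_rev_id_mat[of 1 1] char_poly_smult_rev_id_mat[of "-1" 1]
    by (subst char_poly_block4_diag) (auto simp: char_poly_smult_one_mat rev_id_mat_def)
  moreover have "char_poly ?Q = [:1, 1:] * [:-1, 1:] *
    [:- (2 * real m * real l + real m + real l + 1), - (real m - real l), 1:]"
    by (simp add: char_poly_def det_4_by_4 char_poly_matrix_def algebra_simps)
  ultimately have "char_poly (A4 m l) * ([:1, 1:] ^ 2 * [:-1, 1:] ^ 2) =
    [:1, 1:] ^ (m + 1 + 2) * [:-1, 1:] ^ (l + 1 + 2) *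
      [:- (2 * real m * real l + real m + real l + 1), - (real m - real l), 1:]"
    by (simp add: power_add power2_eq_square mult_ac del: mult_pCons_left mult_pCons_right)
  \<comment> \<open>The radicand is the discriminant
    \<open>(m - l)^2 + 4 (2 m l + m + l + 1)\<close>, expanded.\<close>
  also have "[:- (2 * real m * real l + real m + real l + 1), - (real m - real l), 1:] =
    [:- ((real m - real l + sqrt (real m ^ 2 + real l ^ 2 + 6 * real m * real l
            + 4 * real m + 4 * real l + 4)) / 2), 1:] *
    [:- ((real m - real l - sqrt (real m ^ 2 + real l ^ 2 + 6 * real m * real l
            + 4 * real m + 4 * real l + 4)) / 2), 1:]"
    by (subst quadratic_factors) (auto simp: power2_eq_square field_simps)
  finally show ?thesis
    unfolding eigenvalues_mset_def by (rule proots_cancel_pm_one)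
qed

section \<open>Symmetry, zero diagonal and entries\<close>

text \<open>Parity: \<open>2 i + 1\<close> never equals \<open>2 k\<close>, so at even order the
  antidiagonal misses the diagonal.\<close>

lemma rev_id_mat_diag: "i < 2 * k \<Longrightarrow> rev_id_mat (2 * k) $$ (i, i) = 0"
  unfolding rev_id_mat_def by simp presburger

text \<open>Reduces the structural claims of the theorem to a single entrywise check.\<close>

lemma signed_graph_matrix:
  fixes A :: "real mat"
  assumes A: "A \<in> carrier_mat n n"
    and entries: "\<And>i j. i < n \<Longrightarrow> j < n \<Longrightarrow>
      A $$ (i, j) = A $$ (j, i) \<and> A $$ (i, i) = 0 \<and> A $$ (i, j) \<in> {-1, 0, 1}"
  shows "transpose_mat A = A \<and> (\<forall>i < dim_row A. A $$ (i, i) = 0) \<and>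
    elements_mat A \<subseteq> {-1, 0, 1} \<and> is_signed_graph_adjacency_mat A"
proof (intro conjI)
  show "transpose_mat A = A" using A entries by (intro eq_matI) auto
  show "\<forall>i < dim_row A. A $$ (i, i) = 0" using A entries by auto
  show "elements_mat A \<subseteq> {-1, 0, 1}"
  proof
    fix x assume "x \<in> elements_mat A"
    then obtain i j where "i < n" "j < n" "x = A $$ (i, j)" using A by blast
    with entries show "x \<in> {-1, 0, 1}" by blast
  qed
  show "is_signed_graph_adjacency_mat A"
    by (rule is_signed_graph_adjacency_matI[OF A]) (use entries in blast)+
qed

lemma A1_entries:
  assumes "i < m + 2 * l" "j < m + 2 * l"
  shows "A1 m l $$ (i, j) = A1 m l $$ (j, i) \<and> A1 m l $$ (i, i) = 0 \<and>
    A1 m l $$ (i, j) \<in> {-1, 0, 1}"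
  \<comment> \<open>\<open>i - m\<close> is the index of \<open>i\<close> within the second
    block.\<close>
  using assms rev_id_mat_diag[of "i - m" l]
  by (cases "i < m"; cases "j < m") (auto simp: A1_def ones_mat_def rev_id_mat_def)

lemma A2_entries:
  assumes "i < 2 * m + 2 * l" "j < 2 * m + 2 * l"
  shows "A2 m l $$ (i, j) = A2 m l $$ (j, i) \<and> A2 m l $$ (i, i) = 0 \<and>
    A2 m l $$ (i, j) \<in> {-1, 0, 1}"
  using assms rev_id_mat_diag[of i m] rev_id_mat_diag[of "i - 2 * m" l]
  by (cases "i < 2 * m"; cases "j < 2 * m") (auto simp: A2_def ones_mat_def rev_id_mat_def)

lemma A3_entries:
  assumes "i < m + 1 + 1 + l" "j < m + 1 + 1 + l"
  shows "A3 m l $$ (i, j) = A3 m l $$ (j, i) \<and> A3 m l $$ (i, i) = 0 \<and>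
    A3 m l $$ (i, j) \<in> {-1, 0, 1}"
  using assms by (auto simp: A3_def block4_mat_def ones_mat_def)

lemma A4_entries:
  assumes "i < m + 2 + 2 + l" "j < m + 2 + 2 + l"
  shows "A4 m l $$ (i, j) = A4 m l $$ (j, i) \<and> A4 m l $$ (i, i) = 0 \<and>
    A4 m l $$ (i, j) \<in> {-1, 0, 1}"
  using A4_index_cases[OF assms(1)] A4_index_cases[OF assms(2)]
  by (elim disjE exE conjE) (simp_all add: A4_def block4_mat_def ones_mat_def rev_id_mat_def)

theorem theorem5p1:
  fixes m l :: nat
  assumes "m \<ge> 1" and "l \<ge> 1"
  shows
    "(\<forall>A \<in> {A1 m l, A2 m l, A3 m l, A4 m l}.
        transpose_mat A = A \<and>
        (\<forall>i < dim_row A. A $$ (i, i) = 0) \<and>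
        elements_mat A \<subseteq> {-1, 0, 1} \<and>
        is_signed_graph_adjacency_mat A \<and>
        size {# x \<in># eigenvalues_mset A. x \<noteq> 1 \<and> x \<noteq> -1 #} \<le> 2)
     \<and> A1 m l \<in> carrier_mat (m + 2 * l) (m + 2 * l)
     \<and> eigenvalues_mset (A1 m l) =
         replicate_mset (l + m - 2) (-1) + replicate_mset l 1 +
         {# (real m - 2 + sqrt (real m * (real m + 8 * real l))) / 2,
            (real m - 2 - sqrt (real m * (real m + 8 * real l))) / 2 #}
     \<and> A2 m l \<in> carrier_mat (2 * m + 2 * l) (2 * m + 2 * l)
     \<and> eigenvalues_mset (A2 m l) =
         replicate_mset (m + l - 1) (-1) + replicate_mset (m + l - 1) 1 +
         {# sqrt (1 + 4 * real m * real l), - sqrt (1 + 4 * real m * real l) #}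
     \<and> A3 m l \<in> carrier_mat (m + 1 + 1 + l) (m + 1 + 1 + l)
     \<and> eigenvalues_mset (A3 m l) =
         replicate_mset m (-1) + replicate_mset l 1 +
         {# - real l - 1, real m + 1 #}
     \<and> A4 m l \<in> carrier_mat (m + 2 + 2 + l) (m + 2 + 2 + l)
     \<and> eigenvalues_mset (A4 m l) =
         replicate_mset (m + 1) (-1) + replicate_mset (l + 1) 1 +
         {# (real m - real l + sqrt (real m ^ 2 + real l ^ 2 + 6 * real m * real l
               + 4 * real m + 4 * real l + 4)) / 2,
            (real m - real l - sqrt (real m ^ 2 + real l ^ 2 + 6 * real m * real l
               + 4 * real m + 4 * real l + 4)) / 2 #}"
proof -
  note eigenvalues = A1_eigenvalues[OF assms] A2_eigenvalues[OF assms] A3_eigenvalues A4_eigenvalues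
  have "\<forall>A \<in> {A1 m l, A2 m l, A3 m l, A4 m l}.
      transpose_mat A = A \<and> (\<forall>i < dim_row A. A $$ (i, i) = 0) \<and>
      elements_mat A \<subseteq> {-1, 0, 1} \<and> is_signed_graph_adjacency_mat A \<and>
      size {# x \<in># eigenvalues_mset A. x \<noteq> 1 \<and> x \<noteq> -1 #} \<le> 2"
    (is "\<forall>A \<in> _. ?P A")
  proof
    fix A assume "A \<in> {A1 m l, A2 m l, A3 m l, A4 m l}"
    then consider "A = A1 m l" | "A = A2 m l" | "A = A3 m l" | "A = A4 m l" by blast
    then show "?P A"
    proof cases
      case 1
      \<comment> \<open>Once the spectrum is substituted, the bound on the number of other
        eigenvalues is an instance of \<open>size_filter_le_two\<close>.\<close>
      show ?thesis unfolding 1 eigenvalues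
        using signed_graph_matrix[OF A1_carrier[of m l], OF A1_entries] size_filter_le_two by blast
    next
      case 2
      show ?thesis unfolding 2 eigenvalues
        using signed_graph_matrix[OF A2_carrier[of m l], OF A2_entries] size_filter_le_two by blast
    next
      case 3
      show ?thesis unfolding 3 eigenvalues
        using signed_graph_matrix[OF A3_carrier[of m l], OF A3_entries] size_filter_le_two by blast
    next
      case 4
      show ?thesis unfolding 4 eigenvalues
        using signed_graph_matrix[OF A4_carrier[of m l], OF A4_entries] size_filter_le_two by blast
    qed
  qed
  then show ?thesis
    by (intro conjI eigenvalues A1_carrier A2_carrier A3_carrier A4_carrier)
qed

end
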